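(* Assume Martin's Axiom. Then there exists $X\subseteq P(\mathbb{N})$ such that $X$ is a strong $\gamma$-set, but $X\setminus\mathrm{Fin}$ does not satisfy $\mathsf{U}_{fin}(\Gamma,\mathcal{O})$ and is not a $\tau$-set.
   Context: $P(\mathbb{N})$ is identified with the Cantor space $\{0,1\}^{\mathbb{N}}$ via characteristic functions; $\mathrm{Fin}$ is the set of finite subsets of $\mathbb{N}$. For a space $Y$: an $n$-cover of $Y$ is an open cover such that each subset of $Y$ with at most $n$ elements is contained in some member; an open $\gamma$-cover is an infinite open cover with $Y$ not contained in any member and each point in all but finitely many members; an open $\tau$-cover is an open cover with $Y$ not contained in any member, each point in infinitely many members, and for all $x,y\in Y$ one of $\{U:x\in U,y\notin U\}$, $\{U:y\in U,x\notin U\}$ finite. $Y$ is a strong $\gamma$-set if for each sequence $(\mathcal{U}_n)$ where each $\mathcal{U}_n$ is an $n$-cover of $Y$ there exist $U_n\in\mathcal{U}_n$ such that $\{U_n:n\in\mathbb{N}\}$ is a $\gamma$-cover of $Y$. $\mathcal{O}$, $\Gamma$ are the collections of countable open covers and countable open $\gamma$-covers. $Y$ satisfies $\mathsf{U}_{fin}(\Gamma,\mathcal{O})$ if for each sequence $(\mathcal{U}_n)$ of members of $\Gamma$ none containing a finite subcover, there are finite $\mathcal{F}_n\subseteq\mathcal{U}_n$ with $\{\bigcup\mathcal{F}_n:n\in\mathbb{N}\}$ a cover of $Y$. $Y$ is a $\tau$-set if each clopen $\tau$-cover of $Y$ contains a $\gamma$-cover of $Y$.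
   Formalization: In the definition of strong γ-set, the n-covers are additionally required to have no member containing Y; read literally, {Y} is an n-cover for every n from which no γ-cover can be chosen, so no space would be a strong γ-set. *)

theory Defs
  imports "HOL-Analysis.Analysis" "HOL-Library.Equipollence"
begin

section \<open>Martin's Axiom\<close>

text \<open>A forcing notion is a set \<open>P\<close> with a relation \<open>r\<close>; \<open>(p, q) \<in> r\<close> reads: \<open>p\<close> is stronger
  than \<open>q\<close>, i.e. \<open>p \<le> q\<close>.\<close>

definition compatible_in :: "'p set \<Rightarrow> 'p rel \<Rightarrow> 'p \<Rightarrow> 'p \<Rightarrow> bool" where
  "compatible_in P r p q \<longleftrightarrow> (\<exists>s\<in>P. (s, p) \<in> r \<and> (s, q) \<in> r)"

definition ccc_order :: "'p set \<Rightarrow> 'p rel \<Rightarrow> bool" where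
  "ccc_order P r \<longleftrightarrow>
     (\<forall>A\<subseteq>P. pairwise (\<lambda>p q. \<not> compatible_in P r p q) A \<longrightarrow> countable A)"

definition dense_in_order :: "'p set \<Rightarrow> 'p rel \<Rightarrow> 'p set \<Rightarrow> bool" where
  "dense_in_order P r D \<longleftrightarrow> D \<subseteq> P \<and> (\<forall>p\<in>P. \<exists>d\<in>D. (d, p) \<in> r)"

definition filter_in_order :: "'p set \<Rightarrow> 'p rel \<Rightarrow> 'p set \<Rightarrow> bool" where
  "filter_in_order P r G \<longleftrightarrow> G \<noteq> {} \<and> G \<subseteq> P \<and>
     (\<forall>p\<in>G. \<forall>q\<in>P. (p, q) \<in> r \<longrightarrow> q \<in> G) \<and>
     (\<forall>p\<in>G. \<forall>q\<in>G. \<exists>s\<in>G. (s, p) \<in> r \<and> (s, q) \<in> r)"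

text \<open>HOL cannot quantify over all types, so the partial orders range over those whose carrier is
  a set of reals, i.e. up to isomorphism over all partial orders of size at most the continuum.
  By the usual closing-off argument this is no restriction: Martin's Axiom for the ccc partial
  orders of size less than the continuum already implies it for all of them.\<close>

definition Martins_Axiom :: bool where
  "Martins_Axiom \<longleftrightarrow>
     (\<forall>(P :: real set) r \<D>.
        P \<noteq> {} \<and> partial_order_on P r \<and> ccc_order P r \<and>
        (\<forall>D\<in>\<D>. dense_in_order P r D) \<and> \<D> \<prec> (UNIV :: real set) \<longrightarrow>
        (\<exists>G. filter_in_order P r G \<and> (\<forall>D\<in>\<D>. G \<inter> D \<noteq> {})))"

section \<open>Covers and covering properties\<close>

definition open_cover :: "'a topology \<Rightarrow> 'a set set \<Rightarrow> bool" where
  "open_cover Y \<U> \<longleftrightarrow> (\<forall>U\<in>\<U>. openin Y U) \<and> \<Union>\<U> = topspace Y"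

definition nontrivial_cover :: "'a topology \<Rightarrow> 'a set set \<Rightarrow> bool" where
  "nontrivial_cover Y \<U> \<longleftrightarrow> (\<forall>U\<in>\<U>. \<not> topspace Y \<subseteq> U)"

definition n_cover :: "'a topology \<Rightarrow> nat \<Rightarrow> 'a set set \<Rightarrow> bool" where
  "n_cover Y n \<U> \<longleftrightarrow> open_cover Y \<U> \<and>
     (\<forall>F\<subseteq>topspace Y. finite F \<and> card F \<le> n \<longrightarrow> (\<exists>U\<in>\<U>. F \<subseteq> U))"

definition gamma_cover :: "'a topology \<Rightarrow> 'a set set \<Rightarrow> bool" where
  "gamma_cover Y \<U> \<longleftrightarrow> infinite \<U> \<and> open_cover Y \<U> \<and> nontrivial_cover Y \<U> \<and>
     (\<forall>x\<in>topspace Y. finite {U\<in>\<U>. x \<notin> U})"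

definition tau_cover :: "'a topology \<Rightarrow> 'a set set \<Rightarrow> bool" where
  "tau_cover Y \<U> \<longleftrightarrow> open_cover Y \<U> \<and> nontrivial_cover Y \<U> \<and>
     (\<forall>x\<in>topspace Y. infinite {U\<in>\<U>. x \<in> U}) \<and>
     (\<forall>x\<in>topspace Y. \<forall>y\<in>topspace Y.
        finite {U\<in>\<U>. x \<in> U \<and> y \<notin> U} \<or> finite {U\<in>\<U>. y \<in> U \<and> x \<notin> U})"

text \<open>The \<open>n\<close>-covers below are required to be nontrivial, the usual convention for covers in
  selection principles. Without it no space would be a strong \<open>\<gamma>\<close>-set: \<open>{Y}\<close> is an \<open>n\<close>-cover for
  every \<open>n\<close>, and no \<open>\<gamma>\<close>-cover can be selected from the sequence that is constantly \<open>{Y}\<close>.\<close>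

definition strong_gamma_set :: "'a topology \<Rightarrow> bool" where
  "strong_gamma_set Y \<longleftrightarrow>
     (\<forall>\<U> :: nat \<Rightarrow> 'a set set.
        (\<forall>n. n_cover Y n (\<U> n) \<and> nontrivial_cover Y (\<U> n)) \<longrightarrow>
        (\<exists>U. (\<forall>n. U n \<in> \<U> n) \<and> gamma_cover Y (range U)))"

definition open_covers :: "'a topology \<Rightarrow> 'a set set set" where
  "open_covers Y = {\<U>. countable \<U> \<and> open_cover Y \<U>}"

definition gamma_covers :: "'a topology \<Rightarrow> 'a set set set" where
  "gamma_covers Y = {\<U>. countable \<U> \<and> gamma_cover Y \<U>}"

definition Ufin :: "'a topology \<Rightarrow> 'a set set set \<Rightarrow> 'a set set set \<Rightarrow> bool" where
  "Ufin Y \<AA> \<BB> \<longleftrightarrow>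
     (\<forall>\<U> :: nat \<Rightarrow> 'a set set.
        (\<forall>n. \<U> n \<in> \<AA> \<and> \<not> (\<exists>\<F>\<subseteq>\<U> n. finite \<F> \<and> \<Union>\<F> = topspace Y)) \<longrightarrow>
        (\<exists>\<F>. (\<forall>n. finite (\<F> n) \<and> \<F> n \<subseteq> \<U> n) \<and> range (\<lambda>n. \<Union>(\<F> n)) \<in> \<BB>))"

definition tau_set :: "'a topology \<Rightarrow> bool" where
  "tau_set Y \<longleftrightarrow>
     (\<forall>\<U>. tau_cover Y \<U> \<and> (\<forall>U\<in>\<U>. closedin Y U) \<longrightarrow> (\<exists>\<V>\<subseteq>\<U>. gamma_cover Y \<V>))"

section \<open>The Cantor space of sets of natural numbers\<close>

definition cantor_topology :: "nat set topology" where
  "cantor_topology = pullback_topology UNIV (\<lambda>A n. n \<in> A)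
     (product_topology (\<lambda>_. discrete_topology (UNIV :: bool set)) (UNIV :: nat set))"

definition Fin :: "nat set set" where
  "Fin = {A. finite A}"

end

theory Submission
  imports Defs "HOL-Library.Sublist"
begin

text \<open>The set is \<open>X = T \<union> Fin\<close> for a tower \<open>T\<close>: a family of infinite sets of natural numbers,
  decreasing modulo finite sets along a well-order of length continuum. At each stage Martin's Axiom
  turns one sequence of covers into a selection that is eventually correct for all earlier members,
  together with a pseudo-intersection \<open>a\<close> of these members such that every set almost contained in
  \<open>a\<close> is eventually selected too. For the latter only the finitely many subsets of a finite
  approximation to \<open>a\<close> have to be covered at a time, and an \<open>n\<close>-cover with large \<open>n\<close> does this.
  The new member of \<open>T\<close> is an arbitrarily sparse infinite subset of \<open>a\<close>, so later members and finite
  sets are handled, and \<open>X\<close> is a strong \<open>\<gamma>\<close>-set. Sparseness makes \<open>T\<close> dominating, which refutes the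
  Menger property and leaves \<open>T\<close> without a pseudo-intersection; as \<open>T\<close> is linearly ordered modulo
  finite sets, the sets \<open>{x. n \<in> x}\<close> then form a \<open>\<tau>\<close>-cover without \<open>\<gamma>\<close>-subcover.\<close>

section \<open>Cardinalities below the continuum\<close>

text \<open>Bridge to the ordinal-based theory of cardinals, which bounds disjoint sums and the
  proper initial segments of a well-order of the reals.\<close>

lemma lesspoll_iff_card_of_ordLess:
  includes cardinal_syntax
  shows "A \<prec> B \<longleftrightarrow> |A| <o |B|"
proof -
  have "|A| <o |B| \<longleftrightarrow> \<not> B \<lesssim> A"
    using card_of_ordLess[of B A] by (simp add: lepoll_def)
  moreover have "A \<lesssim> B" if "|A| <o |B|"
    using ordLess_imp_ordLeq[OF that] card_of_ordLeq[of A B] by (simp add: lepoll_def)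
  ultimately show ?thesis
    unfolding lesspoll_def by (meson eqpoll_imp_lepoll eqpoll_sym lepoll_antisym)
qed

lemma countable_lesspoll_real:
  assumes "countable A"
  shows "A \<prec> (UNIV :: real set)"
proof -
  have "\<not> (UNIV :: real set) \<lesssim> A"
    using assms countable_lepoll uncountable_UNIV_real by blast
  then show ?thesis
    unfolding lesspoll_iff_card_of_ordLess
    using card_of_ordLess[of "UNIV :: real set" A] by (simp add: lepoll_def)
qed

lemma nat_set_sequences_lepoll_real: "(UNIV :: (nat \<Rightarrow> nat set) set) \<lesssim> (UNIV :: real set)"
proof -
  have "inj (\<lambda>f :: nat \<Rightarrow> nat set. {n. snd (prod_decode n) \<in> f (fst (prod_decode n))})"
  proof (rule injI)
    fix f g :: "nat \<Rightarrow> nat set"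
    assume eq: "{n. snd (prod_decode n) \<in> f (fst (prod_decode n))}
              = {n. snd (prod_decode n) \<in> g (fst (prod_decode n))}"
    have "j \<in> f i \<longleftrightarrow> j \<in> g i" for i j
      using eq[THEN eqset_imp_iff, of "prod_encode (i, j)"] by simp
    then show "f = g" by blast
  qed
  then have "(UNIV :: (nat \<Rightarrow> nat set) set) \<lesssim> (UNIV :: nat set set)"
    by (auto simp: lepoll_def)
  then show ?thesis
    using lepoll_trans eqpoll_imp_lepoll nat_sets_eqpoll_reals by blast
qed

text \<open>A forcing condition will be a countable part together with a finite family of sets; this
  embeds the conditions into the reals, where \<open>Martins_Axiom\<close> applies.\<close>

lemma finite_families_lepoll_real:
  "{(c :: 'c :: countable, F :: nat set set). finite F} \<lesssim> (UNIV :: real set)"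
proof -
  define lst where "lst F = (SOME xs. set xs = F)" for F :: "nat set set"
  have lst: "set (lst F) = F" if "finite F" for F
    unfolding lst_def using finite_list[OF that] by (rule someI_ex)
  \<comment> \<open>Entry 0 records the list length as well, so padding with \<open>{}\<close>
    cannot identify lists of different lengths.\<close>
  define code where "code = (\<lambda>(c :: 'c, F). case_nat {to_nat (c, length (lst F))}
      (\<lambda>i. if i < length (lst F) then lst F ! i else {}))"
  have "inj_on code {(c, F). finite F}"
  proof (rule inj_onI, clarify)
    fix c d F G assume fin: "finite F" "finite G" and eq: "code (c, F) = code (d, G)"
    have 0: "c = d" "length (lst F) = length (lst G)"
      using fun_cong[OF eq, of 0] by (auto simp: code_def)
    have "lst F = lst G"
    proof (rule nth_equalityI)
      fix i assume "i < length (lst F)"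
      then show "lst F ! i = lst G ! i"
        using fun_cong[OF eq, of "Suc i"] 0 by (auto simp: code_def)
    qed (use 0 in auto)
    then show "c = d \<and> F = G" using 0(1) lst[OF fin(1)] lst[OF fin(2)] by metis
  qed
  then have "{(c :: 'c, F :: nat set set). finite F} \<lesssim> (UNIV :: (nat \<Rightarrow> nat set) set)"
    by (auto simp: lepoll_def)
  then show ?thesis
    using lepoll_trans nat_set_sequences_lepoll_real by blast
qed

section \<open>Martin's Axiom for partial orders that are centered over countably many stems\<close>

text \<open>Conditions with equal stems are compatible, so an antichain injects into the countable
  type of stems and ccc follows. The order is transported to a set of reals along an injection, and
  the filter is pulled back.\<close>

lemma Martins_Axiom_countable_stems:
  fixes P :: "'p set" and le :: "'p \<Rightarrow> 'p \<Rightarrow> bool" and stem :: "'p \<Rightarrow> 'c :: countable"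
    and D :: "'i \<Rightarrow> 'p \<Rightarrow> bool"
  assumes MA: Martins_Axiom
    and P: "P \<noteq> {}" "P \<lesssim> (UNIV :: real set)"
    and refl: "\<And>p. p \<in> P \<Longrightarrow> le p p"
    and antisym: "\<And>p q. p \<in> P \<Longrightarrow> q \<in> P \<Longrightarrow> le p q \<Longrightarrow> le q p \<Longrightarrow> p = q"
    and trans: "\<And>p q r. p \<in> P \<Longrightarrow> q \<in> P \<Longrightarrow> r \<in> P \<Longrightarrow> le p q \<Longrightarrow> le q r \<Longrightarrow> le p r"
    and compat: "\<And>p q. p \<in> P \<Longrightarrow> q \<in> P \<Longrightarrow> stem p = stem q \<Longrightarrow> \<exists>s\<in>P. le s p \<and> le s q"
    and I: "I \<prec> (UNIV :: real set)"
    and dense: "\<And>i p. i \<in> I \<Longrightarrow> p \<in> P \<Longrightarrow> \<exists>q\<in>P. le q p \<and> D i q"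
  obtains G where "G \<noteq> {}" "G \<subseteq> P" "\<forall>p\<in>G. \<forall>q\<in>G. \<exists>s\<in>G. le s p \<and> le s q"
    "\<forall>i\<in>I. \<exists>p\<in>G. D i p"
proof -
  obtain h :: "'p \<Rightarrow> real" where h: "inj_on h P"
    using P(2) by (auto simp: lepoll_def)
  define r where "r = {(h p, h q) | p q. p \<in> P \<and> q \<in> P \<and> le p q}"
  have r_iff: "(h p, h q) \<in> r \<longleftrightarrow> le p q" if "p \<in> P" "q \<in> P" for p q
    using that h by (auto simp: r_def inj_on_def)
  have po: "partial_order_on (h ` P) r"
    unfolding partial_order_on_def preorder_on_def
  proof (intro conjI)
    show "refl_on (h ` P) r"
      by (rule refl_onI) (auto simp: r_iff refl)
    show "r \<subseteq> h ` P \<times> h ` P" by (auto simp: r_def)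
    show "trans r"
    proof (rule transI)
      fix x y z assume "(x, y) \<in> r" "(y, z) \<in> r"
      then obtain p q q' s where *: "x = h p" "y = h q" "y = h q'" "z = h s" "p \<in> P" "q \<in> P" "q' \<in> P"
        "s \<in> P" "le p q" "le q' s" by (auto simp: r_def)
      moreover have "q = q'" using * h by (auto simp: inj_on_def)
      ultimately show "(x, z) \<in> r" using trans r_iff by blast
    qed
    show "antisym r"
    proof (rule antisymI)
      fix x y assume "(x, y) \<in> r" "(y, x) \<in> r"
      moreover from this obtain p q where "x = h p" "y = h q" "p \<in> P" "q \<in> P"
        by (auto simp: r_def)
      ultimately show "x = y" using antisym r_iff by blast
    qed
  qed
  have ccc: "ccc_order (h ` P) r"
    unfolding ccc_order_def
  proof (intro allI impI)
    fix A assume A: "A \<subseteq> h ` P" "pairwise (\<lambda>p q. \<not> compatible_in (h ` P) r p q) A"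
    then obtain Q where Q: "Q \<subseteq> P" "A = h ` Q" by (meson subset_imageE)
    have "inj_on stem Q"
    proof (rule inj_onI, rule ccontr)
      fix p q assume pq: "p \<in> Q" "q \<in> Q" "stem p = stem q" "p \<noteq> q"
      then obtain s where "s \<in> P" "le s p" "le s q" using compat Q by blast
      then have "compatible_in (h ` P) r (h p) (h q)"
        using pq Q by (auto simp: compatible_in_def r_iff subset_iff)
      moreover have "h p \<noteq> h q" using pq Q h by (auto simp: inj_on_def)
      ultimately show False using A(2) Q pq by (auto simp: pairwise_def)
    qed
    then have "countable Q"
      by (metis countableI_type countable_image_inj_on)
    then show "countable A" using Q by simp
  qed
  define E where "E i = h ` {q \<in> P. D i q}" for i
  have "dense_in_order (h ` P) r (E i)" if i: "i \<in> I" for i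
    unfolding dense_in_order_def E_def
  proof (intro conjI ballI)
    fix x assume "x \<in> h ` P"
    then obtain p where p: "x = h p" "p \<in> P" by auto
    then obtain q where "q \<in> P" "le q p" "D i q" using dense[OF i] by blast
    then show "\<exists>d\<in>h ` {q \<in> P. D i q}. (d, x) \<in> r" using p by (auto simp: r_iff)
  qed auto
  moreover have "E ` I \<prec> (UNIV :: real set)"
    using image_lepoll I lesspoll_trans1 by blast
  ultimately obtain H where H: "filter_in_order (h ` P) r H" "\<And>i. i \<in> I \<Longrightarrow> H \<inter> E i \<noteq> {}"
    using MA[unfolded Martins_Axiom_def, rule_format, of "h ` P" r "E ` I"] po ccc P(1)
    by (auto simp: ball_simps)
  show thesis
  proof (rule that[of "{p \<in> P. h p \<in> H}"])
    show "{p \<in> P. h p \<in> H} \<noteq> {}"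
      using H(1) by (auto simp: filter_in_order_def)
    show "\<forall>p\<in>{p \<in> P. h p \<in> H}. \<forall>q\<in>{p \<in> P. h p \<in> H}. \<exists>s\<in>{p \<in> P. h p \<in> H}. le s p \<and> le s q"
    proof (intro ballI)
      fix p q assume pq: "p \<in> {p \<in> P. h p \<in> H}" "q \<in> {p \<in> P. h p \<in> H}"
      with H(1) obtain x where x: "x \<in> H" "(x, h p) \<in> r" "(x, h q) \<in> r"
        unfolding filter_in_order_def by blast
      moreover obtain s where "s \<in> P" "x = h s"
        using x H(1) by (auto simp: filter_in_order_def)
      ultimately show "\<exists>s\<in>{p \<in> P. h p \<in> H}. le s p \<and> le s q" using pq by (auto simp: r_iff)
    qed
    show "\<forall>i\<in>I. \<exists>p\<in>{p \<in> P. h p \<in> H}. D i p"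
      using H(2) by (fastforce simp: E_def)
  qed auto
qed

section \<open>Selecting from a sequence of covers\<close>

text \<open>\<open>B\<close> decodes a natural number to an open set and \<open>W n\<close> holds
  the codes admissible at position \<open>n\<close>, so finite selections are lists of numbers and
  there are only countably many. \<open>C\<close> stands for the tower members built so far.\<close>

locale cover_selection =
  fixes B :: "nat \<Rightarrow> nat set set" and W :: "nat \<Rightarrow> nat set" and C :: "nat set set"
  assumes B_open: "t \<in> B k \<Longrightarrow> \<exists>m. \<forall>z. z \<inter> {..<m} = t \<inter> {..<m} \<longrightarrow> z \<in> B k"
    and W_covers: "H \<subseteq> C \<union> Fin \<Longrightarrow> finite H \<Longrightarrow> card H \<le> n \<Longrightarrow> \<exists>k\<in>W n. H \<subseteq> B k"
    and C_centered: "H \<subseteq> C \<Longrightarrow> finite H \<Longrightarrow> infinite (\<Inter>H)"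
begin

text \<open>A condition \<open>(s, u, F, M)\<close> approximates a pseudo-intersection by \<open>s\<close> and a selection by \<open>u\<close>.
  It promises that later elements of \<open>s\<close> are at least \<open>M\<close> and lie in every member of \<open>F\<close>, and that
  later members of the selection contain \<open>F\<close> and all sets that can still become a subset of
  \<open>{..<length s}\<close> together with the pseudo-intersection. The factor \<open>2\<close> before \<open>card F\<close>
  makes room for the promises of two conditions with the same \<open>s\<close>, \<open>u\<close>, \<open>M\<close>.\<close>

definition conds :: "(nat list \<times> nat list \<times> nat set set \<times> nat) set" where
  "conds = {(s, u, F, M). finite F \<and> F \<subseteq> C \<and> (\<forall>i<length u. u ! i \<in> W i) \<and>
     2 ^ (2 * length s) + 2 * card F \<le> length u}"

fun ext :: "nat list \<times> nat list \<times> nat set set \<times> nat \<Rightarrow>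
    nat list \<times> nat list \<times> nat set set \<times> nat \<Rightarrow> bool" where
  "ext (s', u', F', M') (s, u, F, M) \<longleftrightarrow>
     prefix s s' \<and> prefix u u' \<and> F \<subseteq> F' \<and> M \<le> M' \<and> set s' \<subseteq> set s \<union> ({M..} \<inter> \<Inter>F) \<and>
     (\<forall>i. length u \<le> i \<and> i < length u' \<longrightarrow> F \<subseteq> B (u' ! i) \<and>
        (\<forall>z. z \<subseteq> {..<length s} \<union> set s' \<union> {M'..} \<longrightarrow> z \<in> B (u' ! i)))"

section \<open>The extension relation is a partial order\<close>

lemma ext_refl: "ext p p"
  by (cases p) auto

lemma ext_antisym: "ext p q \<Longrightarrow> ext q p \<Longrightarrow> p = q"
  by (cases p; cases q) (auto simp: prefix_order.eq_iff)

text \<open>The region \<open>{..<length s} \<union> set s' \<union> {M'..}\<close> shrinks as the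
  stronger condition is strengthened and grows with \<open>s\<close>. So entries already promised
  stay correct, and newer entries inherit the promise of the middle condition.\<close>

lemma ext_trans:
  assumes "ext p q" "ext q r" shows "ext p r"
proof -
  obtain s2 u2 F2 M2 where p: "p = (s2, u2, F2, M2)" by (cases p)
  obtain s1 u1 F1 M1 where q: "q = (s1, u1, F1, M1)" by (cases q)
  obtain s u F M where r: "r = (s, u, F, M)" by (cases r)
  have 1: "prefix s1 s2" "prefix u1 u2" "F1 \<subseteq> F2" "M1 \<le> M2" "set s2 \<subseteq> set s1 \<union> ({M1..} \<inter> \<Inter>F1)"
    "\<And>i. length u1 \<le> i \<Longrightarrow> i < length u2 \<Longrightarrow> F1 \<subseteq> B (u2 ! i) \<and>
        (\<forall>z. z \<subseteq> {..<length s1} \<union> set s2 \<union> {M2..} \<longrightarrow> z \<in> B (u2 ! i))"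
    using assms(1) by (auto simp: p q)
  have 2: "prefix s s1" "prefix u u1" "F \<subseteq> F1" "M \<le> M1" "set s1 \<subseteq> set s \<union> ({M..} \<inter> \<Inter>F)"
    "\<And>i. length u \<le> i \<Longrightarrow> i < length u1 \<Longrightarrow> F \<subseteq> B (u1 ! i) \<and>
        (\<forall>z. z \<subseteq> {..<length s} \<union> set s1 \<union> {M1..} \<longrightarrow> z \<in> B (u1 ! i))"
    using assms(2) by (auto simp: q r)
  have "F \<subseteq> B (u2 ! i) \<and> (\<forall>z. z \<subseteq> {..<length s} \<union> set s2 \<union> {M2..} \<longrightarrow> z \<in> B (u2 ! i))"
    if i: "length u \<le> i" "i < length u2" for i
  proof (cases "i < length u1")
    case True
    then have eq: "u2 ! i = u1 ! i" using 1(2) by (auto simp: prefix_def nth_append)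
    have "{..<length s} \<union> set s2 \<union> {M2..} \<subseteq> {..<length s} \<union> set s1 \<union> {M1..}"
      using 1 by auto
    then show ?thesis using 2(6)[OF i(1) True] eq by (metis subset_trans)
  next
    case False
    have "length s \<le> length s1" using 2(1) by (rule prefix_length_le)
    then have "{..<length s} \<union> set s2 \<union> {M2..} \<subseteq> {..<length s1} \<union> set s2 \<union> {M2..}"
      by auto
    then show ?thesis using 1(6)[of i] False i 2(3) by (meson not_less subset_trans)
  qed
  moreover have "set s2 \<subseteq> set s \<union> ({M..} \<inter> \<Inter>F)"
    using 1(5) 2(3-5) by fastforce
  ultimately show ?thesis
    using 1 2 unfolding p r by (auto intro: prefix_order.trans)
qed

text \<open>\<open>F\<close> together with all subsets of
  \<open>{..<length s} \<union> set s\<close> has at most \<open>n\<close> elements, so one member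
  of the \<open>n\<close>-th cover contains them all. It is open, so these finite sets stay inside
  it when elements beyond some \<open>M'\<close> are added.\<close>

lemma select_one:
  assumes F: "finite F" "F \<subseteq> C" and len: "2 ^ (2 * length s) + card F \<le> n"
  obtains k M' where "k \<in> W n" "M \<le> M'" "F \<subseteq> B k"
    "\<And>z. z \<subseteq> {..<length s} \<union> set s \<union> {M'..} \<Longrightarrow> z \<in> B k"
proof -
  define T where "T = {..<length s} \<union> set s"
  have T: "finite T" "card T \<le> 2 * length s"
    using card_Un_le[of "{..<length s}" "set s"] card_length[of s] by (auto simp: T_def)
  have "card (F \<union> Pow T) \<le> card F + 2 ^ card T"
    using card_Un_le[of F "Pow T"] T by (simp add: card_Pow)
  also have "\<dots> \<le> card F + 2 ^ (2 * length s)"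
    using T by (simp add: power_increasing)
  finally have "card (F \<union> Pow T) \<le> n" using len by simp
  moreover have "F \<union> Pow T \<subseteq> C \<union> Fin"
    using F T by (auto simp: Fin_def intro: finite_subset)
  ultimately obtain k where k: "k \<in> W n" "F \<union> Pow T \<subseteq> B k"
    using W_covers[of "F \<union> Pow T" n] F T by auto
  have "\<forall>t\<in>Pow T. \<exists>m. \<forall>z. z \<inter> {..<m} = t \<inter> {..<m} \<longrightarrow> z \<in> B k"
    using B_open k by blast
  then obtain m where m: "\<And>t z. t \<subseteq> T \<Longrightarrow> z \<inter> {..<m t} = t \<inter> {..<m t} \<Longrightarrow> z \<in> B k"
    by (metis PowI)
  define M' where "M' = Max (insert M (m ` Pow T))"
  have M': "M \<le> M'" "\<And>t. t \<subseteq> T \<Longrightarrow> m t \<le> M'"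
    using T by (auto simp: M'_def intro!: Max_ge)
  have "z \<in> B k" if "z \<subseteq> T \<union> {M'..}" for z
  \<comment> \<open>Outside \<open>T\<close>, \<open>z\<close> has only elements from
    \<open>M'\<close> on, so it agrees with the subset \<open>z \<inter> T\<close> of
    \<open>T\<close> on the relevant initial segment.\<close>
  proof (rule m[of "z \<inter> T"])
    show "z \<inter> {..<m (z \<inter> T)} = z \<inter> T \<inter> {..<m (z \<inter> T)}"
      using that M'(2)[of "z \<inter> T"] by fastforce
  qed auto
  then show thesis using that k M'(1) by (simp add: T_def)
qed

text \<open>Iterates \<open>select_one\<close>: \<open>s\<close> and \<open>F\<close> stay fixed, so
  the size requirement persists as \<open>u\<close> grows. The bound has \<open>card F\<close>
  without the factor 2, so the union of two promise sets qualifies.\<close>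

lemma lengthen_selection:
  assumes F: "finite F" "F \<subseteq> C" and u: "\<forall>i<length u. u ! i \<in> W i"
    and len: "2 ^ (2 * length s) + card F \<le> length u"
  shows "\<exists>u' M'. length u \<le> length u' \<and> n \<le> length u' \<and> (\<forall>i<length u'. u' ! i \<in> W i) \<and>
    ext (s, u', F, M') (s, u, F, M)"
proof (induction n)
  case 0
  show ?case using u ext_refl by blast
next
  case (Suc n)
  then obtain u' M' where u': "length u \<le> length u'" "n \<le> length u'" "\<forall>i<length u'. u' ! i \<in> W i"
    "ext (s, u', F, M') (s, u, F, M)" by blast
  obtain k M'' where k: "k \<in> W (length u')" "M' \<le> M''" "F \<subseteq> B k"
    "\<And>z. z \<subseteq> {..<length s} \<union> set s \<union> {M''..} \<Longrightarrow> z \<in> B k"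
    using select_one[OF F, of s "length u'" M'] len u'(1) by auto
  have "ext (s, u' @ [k], F, M'') (s, u', F, M')"
    using k by (auto simp: nth_append)
  then have "ext (s, u' @ [k], F, M'') (s, u, F, M)"
    using u'(4) ext_trans by blast
  moreover have "\<forall>i<length (u' @ [k]). (u' @ [k]) ! i \<in> W i"
    using u'(3) k(1) by (auto simp: nth_append less_Suc_eq)
  ultimately show ?case using u'(1,2)
    by (intro exI[of _ "u' @ [k]"] exI[of _ M'']) auto
qed

section \<open>The forcing notion: size, compatibility and density\<close>

lemma conds_nonempty: "conds \<noteq> {}"
proof -
  have "\<exists>k. k \<in> W i" for i using W_covers[of "{}" i] by auto
  then obtain w where "\<And>i. w i \<in> W i" by metis
  \<comment> \<open>One entry is required even for empty \<open>s\<close> and \<open>F\<close>,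
    since \<open>2 ^ 0 = 1\<close>.\<close>
  then have "([], [w 0], {}, 0) \<in> conds" by (auto simp: conds_def)
  then show ?thesis by blast
qed

lemma conds_lepoll_real: "conds \<lesssim> (UNIV :: real set)"
proof -
  have "inj_on (\<lambda>(s, u, F, M). ((s, u, M), F)) conds"
    by (auto simp: inj_on_def)
  moreover have "(\<lambda>(s, u, F, M). ((s, u, M), F)) ` conds \<subseteq> {(c, F). finite F}"
    by (auto simp: conds_def)
  ultimately have "conds \<lesssim> {(c :: nat list \<times> nat list \<times> nat, F :: nat set set). finite F}"
    unfolding lepoll_def by blast
  then show ?thesis using lepoll_trans finite_families_lepoll_real by blast
qed

text \<open>Each of \<open>F\<close> and \<open>G\<close> takes at most half of what
  \<open>length u\<close> leaves, so their union can still be promised; lengthening the selection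
  then restores the factor 2.\<close>

lemma conds_compatible:
  assumes p: "(s, u, F, M) \<in> conds" and q: "(s, u, G, M) \<in> conds"
  shows "\<exists>r\<in>conds. ext r (s, u, F, M) \<and> ext r (s, u, G, M)"
proof -
  let ?H = "F \<union> G"
  have H: "finite ?H" "?H \<subseteq> C" "\<forall>i<length u. u ! i \<in> W i"
    "2 ^ (2 * length s) + card ?H \<le> length u"
    using p q card_Un_le[of F G] by (auto simp: conds_def)
  obtain u' M' where u': "2 ^ (2 * length s) + 2 * card ?H \<le> length u'"
    "\<forall>i<length u'. u' ! i \<in> W i" "ext (s, u', ?H, M') (s, u, ?H, M)"
    using lengthen_selection[OF H] by blast
  have "(s, u', ?H, M') \<in> conds"
    using u' H by (auto simp: conds_def)
  moreover have "ext (s, u, ?H, M) (s, u, F, M)" "ext (s, u, ?H, M) (s, u, G, M)"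
    by auto
  ultimately show ?thesis using u'(3) ext_trans by blast
qed

text \<open>The selection is lengthened under the old promise first, which makes room for one more
  set.\<close>

lemma dense_promise:
  assumes p: "p \<in> conds" and x: "x \<in> C"
  shows "\<exists>s u F M. (s, u, F, M) \<in> conds \<and> ext (s, u, F, M) p \<and> x \<in> F"
proof -
  obtain s u F M where pe: "p = (s, u, F, M)" by (cases p)
  have H: "finite F" "F \<subseteq> C" "\<forall>i<length u. u ! i \<in> W i"
    "2 ^ (2 * length s) + card F \<le> length u"
    using p by (auto simp: conds_def pe)
  obtain u' M' where u': "2 ^ (2 * length s) + 2 * (card F + 1) \<le> length u'"
    "\<forall>i<length u'. u' ! i \<in> W i" "ext (s, u', F, M') (s, u, F, M)"
    using lengthen_selection[OF H] by blast
  have "card (insert x F) \<le> card F + 1"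
    by (simp add: card_insert_le_m1 card_insert_if H)
  then have "(s, u', insert x F, M') \<in> conds"
    using u' H x by (auto simp: conds_def)
  moreover have "ext (s, u', insert x F, M') (s, u', F, M')" by auto
  ultimately show ?thesis using u'(3) ext_trans unfolding pe by blast
qed

text \<open>A longer \<open>s\<close> quadruples the exponential bound, so the selection grows
  first. Centeredness of \<open>C\<close> then supplies an element of \<open>\<Inter>F\<close>
  beyond the new \<open>M'\<close>.\<close>

lemma append_element:
  assumes p: "(s, u, F, M) \<in> conds"
  shows "\<exists>e u' M'. j \<le> e \<and> (s @ [e], u', F, M') \<in> conds \<and> ext (s @ [e], u', F, M') (s, u, F, M)"
proof -
  have H: "finite F" "F \<subseteq> C" "\<forall>i<length u. u ! i \<in> W i"
    "2 ^ (2 * length s) + card F \<le> length u"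
    using p by (auto simp: conds_def)
  obtain u' M' where u': "2 ^ (2 * Suc (length s)) + 2 * card F \<le> length u'"
    "\<forall>i<length u'. u' ! i \<in> W i" "ext (s, u', F, M') (s, u, F, M)"
    using lengthen_selection[OF H] by blast
  obtain e where e: "e \<in> \<Inter>F" "max j M' \<le> e"
    using C_centered[OF H(2,1)] by (meson infinite_nat_iff_unbounded_le)
  have "(s @ [e], u', F, M') \<in> conds"
    using u' H by (auto simp: conds_def)
  moreover have "ext (s @ [e], u', F, M') (s, u', F, M')" using e by auto
  ultimately show ?thesis using e u'(3) ext_trans by (meson max.bounded_iff)
qed

text \<open>Large elements make the pseudo-intersection infinite; large \<open>length s\<close> lets
  the promises absorb any finite deviation from it.\<close>

lemma dense_elements:
  assumes p: "p \<in> conds"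
  shows "\<exists>s u F M. (s, u, F, M) \<in> conds \<and> ext (s, u, F, M) p \<and> j \<le> length s \<and> (\<exists>e\<in>set s. j \<le> e)"
proof -
  have "\<exists>s u F M. (s, u, F, M) \<in> conds \<and> ext (s, u, F, M) p \<and> i \<le> length s" for i
  proof (induction i)
    case 0
    show ?case using p ext_refl by (metis prod_cases4 zero_le)
  next
    case (Suc i)
    then obtain s u F M where *: "(s, u, F, M) \<in> conds" "ext (s, u, F, M) p" "i \<le> length s"
      by blast
    obtain e u' M' where **: "(s @ [e], u', F, M') \<in> conds" "ext (s @ [e], u', F, M') (s, u, F, M)"
      using append_element[OF *(1)] by blast
    have "Suc i \<le> length (s @ [e])" using * by simp
    then show ?case using ** ext_trans[OF **(2) *(2)] by blast
  qed
  then obtain s u F M where *: "(s, u, F, M) \<in> conds" "ext (s, u, F, M) p" "j \<le> length s"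
    by blast
  obtain e u' M' where **: "j \<le> e" "(s @ [e], u', F, M') \<in> conds"
      "ext (s @ [e], u', F, M') (s, u, F, M)"
    using append_element[OF *(1)] by blast
  have "j \<le> length (s @ [e])" "\<exists>e\<in>set (s @ [e]). j \<le> e" using * ** by simp_all
  then show ?thesis using ** ext_trans[OF **(3) *(2)] by blast
qed

section \<open>Reading the selection and the pseudo-intersection off a sufficiently generic
  filter\<close>

declare ext.simps [simp del]

theorem selection_with_pseudo_intersection:
  assumes MA: Martins_Axiom and C: "C \<prec> (UNIV :: real set)"
  obtains v a where "\<And>n. v n \<in> W n" "infinite a" "\<And>x. x \<in> C \<Longrightarrow> finite (a - x)"
    "\<And>x. x \<in> C \<Longrightarrow> \<forall>\<^sub>\<infinity>n. x \<in> B (v n)" "\<And>y. finite (y - a) \<Longrightarrow> \<forall>\<^sub>\<infinity>n. y \<in> B (v n)"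
proof -
  \<comment> \<open>One dense set for each \<open>x\<close> in \<open>C\<close>, which must get
    promised, and one for each bound \<open>j\<close> on the stem.\<close>
  define D where "D = (\<lambda>i (s, u :: nat list, F :: nat set set, M :: nat). case i of
      Inl x \<Rightarrow> x \<in> F
    | Inr j \<Rightarrow> j \<le> length s \<and> (\<exists>e\<in>set s. j \<le> e))"
  have small: "C <+> (UNIV :: nat set) \<prec> (UNIV :: real set)"
    using C countable_lesspoll_real[of "UNIV :: nat set"] infinite_UNIV_char_0
    unfolding lesspoll_iff_card_of_ordLess
    by (intro card_of_Plus_ordLess_infinite) auto
  have dense: "\<exists>q\<in>conds. ext q p \<and> D i q" if p: "p \<in> conds" and i: "i \<in> C <+> UNIV" for i p
  proof (cases i)
    case (Inl x)
    then show ?thesis using dense_promise[OF p, of x] i unfolding D_def by fastforce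
  next
    case (Inr j)
    obtain s u F M where "(s, u, F, M) \<in> conds" "ext (s, u, F, M) p" "D i (s, u, F, M)"
      using dense_elements[OF p, of j] Inr unfolding D_def by fastforce
    then show ?thesis by blast
  qed
  have compat: "\<exists>r\<in>conds. ext r p \<and> ext r q" if "p \<in> conds" "q \<in> conds"
      "(case p of (s, u, F, M) \<Rightarrow> (s, u, M)) = (case q of (s, u, F, M) \<Rightarrow> (s, u, M))" for p q
    using that conds_compatible by (cases p; cases q) simp
  obtain G where G: "G \<noteq> {}" "G \<subseteq> conds" "\<forall>p\<in>G. \<forall>q\<in>G. \<exists>s\<in>G. ext s p \<and> ext s q"
    and D: "\<forall>i\<in>C <+> (UNIV :: nat set). \<exists>p\<in>G. D i p"
    by (rule Martins_Axiom_countable_stems[where P = conds and le = ext and D = D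
        and I = "C <+> (UNIV :: nat set)"
        and stem = "\<lambda>(s, u, F, M). (s, u, M)", OF MA conds_nonempty conds_lepoll_real
          ext_refl ext_antisym ext_trans compat small dense])
  have D1: "\<exists>s u F M. (s, u, F, M) \<in> G \<and> x \<in> F" if "x \<in> C" for x
    using D[rule_format, of "Inl x"] that by (auto simp: D_def)
  have D2: "\<exists>s u F M. (s, u, F, M) \<in> G \<and> j \<le> length s \<and> (\<exists>e\<in>set s. j \<le> e)" for j
    using bspec[OF D InrI, of j] by (fastforce simp: D_def)
  \<comment> \<open>Long selections come with long stems, as \<open>conds\<close> forces
    \<open>2 ^ (2 * length s) \<le> length u\<close>.\<close>
  have long: "\<exists>s u F M. (s, u, F, M) \<in> G \<and> j < length u" for j
  proof -
    obtain s u F M where p: "(s, u, F, M) \<in> G" "j \<le> length s" using D2 by blast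
    have "j < 2 ^ (2 * length s)"
      using p(2) less_exp[of "2 * length s"] by linarith
    also have "\<dots> \<le> length u" using p(1) G(2) by (auto simp: conds_def)
    finally show ?thesis using p by blast
  qed
  define a where "a = (\<Union>(s, u, F, M)\<in>G. set s)"
  \<comment> \<open>The choice is harmless: the filter is directed, so any two of its selections are
    prefixes of a common one.\<close>
  define v where "v n = (SOME k. \<exists>s u F M. (s, u, F, M) \<in> G \<and> n < length u \<and> k = u ! n)" for n
  have v: "v n = u ! n" if p: "(s, u, F, M) \<in> G" "n < length u" for s u F M n
  proof -
    have "\<exists>k s u F M. (s, u, F, M) \<in> G \<and> n < length u \<and> k = u ! n"
      using that by blast
    then have "\<exists>s u F M. (s, u, F, M) \<in> G \<and> n < length u \<and> v n = u ! n"
      unfolding v_def by (rule someI_ex)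
    then obtain s' u' F' M' where q: "(s', u', F', M') \<in> G" "n < length u'" "v n = u' ! n"
      by blast
    obtain s'' u'' F'' M'' where "ext (s'', u'', F'', M'') (s, u, F, M)"
      "ext (s'', u'', F'', M'') (s', u', F', M')"
      using G(3)[rule_format, OF p(1) q(1)] by (metis prod_cases4)
    then have "prefix u u''" "prefix u' u''" by (simp_all add: ext.simps)
    then show ?thesis using p(2) q(2,3) by (metis prefix_def nth_append)
  qed
  have a_sub: "a \<subseteq> set s \<union> ({M..} \<inter> \<Inter>F)" if p: "(s, u, F, M) \<in> G" for s u F M
  proof
    fix e assume "e \<in> a"
    then obtain s' u' F' M' where q: "(s', u', F', M') \<in> G" "e \<in> set s'" by (auto simp: a_def)
    obtain s'' u'' F'' M'' where *: "ext (s'', u'', F'', M'') (s, u, F, M)"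
      "ext (s'', u'', F'', M'') (s', u', F', M')"
      using G(3)[rule_format, OF p q(1)] by (metis prod_cases4)
    have "e \<in> set s''" using *(2) q(2) set_mono_prefix by (auto simp: ext.simps)
    then show "e \<in> set s \<union> ({M..} \<inter> \<Inter>F)" using *(1) by (auto simp: ext.simps)
  qed
  \<comment> \<open>A common extension with a selection longer than \<open>i\<close> made its
    promise for all sets inside \<open>{..<length s} \<union> set s'' \<union> {M''..}\<close>, and
    \<open>a_sub\<close> places \<open>a\<close> in that region.\<close>
  have later: "F \<subseteq> B (v i) \<and> (\<forall>z. z \<subseteq> {..<length s} \<union> a \<longrightarrow> z \<in> B (v i))"
    if p: "(s, u, F, M) \<in> G" and i: "length u \<le> i" for s u F M i
  proof -
    obtain s' u' F' M' where q: "(s', u', F', M') \<in> G" "i < length u'" using long by blast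
    obtain s'' u'' F'' M'' where *: "(s'', u'', F'', M'') \<in> G"
      "ext (s'', u'', F'', M'') (s, u, F, M)" "ext (s'', u'', F'', M'') (s', u', F', M')"
      using G(3)[rule_format, OF p q(1)] by (metis prod_cases4)
    have i': "i < length u''" using *(3) q(2) prefix_length_le by (fastforce simp: ext.simps)
    have "a \<subseteq> set s'' \<union> {M''..}" using a_sub[OF *(1)] by auto
    then have "{..<length s} \<union> a \<subseteq> {..<length s} \<union> set s'' \<union> {M''..}" by auto
    then show ?thesis
      using *(2) i i' v[OF *(1) i'] unfolding ext.simps by (metis subset_trans)
  qed
  show thesis
  proof (rule that)
    fix n
    obtain s u F M where p: "(s, u, F, M) \<in> G" "n < length u" using long by blast
    then show "v n \<in> W n" using v G(2) by (auto simp: conds_def)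
  next
    have "\<exists>e\<in>a. j \<le> e" for j using D2[of j] unfolding a_def by fastforce
    then show "infinite a" unfolding infinite_nat_iff_unbounded_le by blast
  next
    fix x assume "x \<in> C"
    then obtain s u F M where p: "(s, u, F, M) \<in> G" "x \<in> F" using D1 by blast
    then have "a - x \<subseteq> set s" using a_sub[OF p(1)] by auto
    then show "finite (a - x)" using finite_subset by blast
    show "\<forall>\<^sub>\<infinity>n. x \<in> B (v n)"
      unfolding MOST_nat_le using later[OF p(1)] p(2) by blast
  next
    fix y assume "finite (y - a)"
    then obtain j where j: "y - a \<subseteq> {..<j}" by (meson finite_nat_bounded)
    obtain s u F M where p: "(s, u, F, M) \<in> G" "j \<le> length s" using D2 by blast
    then have "y \<subseteq> {..<length s} \<union> a" using j by auto
    then show "\<forall>\<^sub>\<infinity>n. y \<in> B (v n)"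
      unfolding MOST_nat_le using later[OF p(1)] by blast
  qed
qed

end

section \<open>The Cantor space\<close>

lemma topspace_cantor [simp]: "topspace cantor_topology = UNIV"
  by (simp add: cantor_topology_def topspace_pullback_topology)

text \<open>A basic open set of the product restricts finitely many coordinates, so the sets with a
  prescribed initial segment form a base.\<close>

lemma openin_cantor_iff:
  "openin cantor_topology W \<longleftrightarrow> (\<forall>x\<in>W. \<exists>m. \<forall>z. z \<inter> {..<m} = x \<inter> {..<m} \<longrightarrow> z \<in> W)"
proof
  assume "openin cantor_topology W"
  then obtain U where U: "openin (product_topology (\<lambda>_. discrete_topology (UNIV :: bool set))
      (UNIV :: nat set)) U" "W = (\<lambda>A n. n \<in> A) -` U"
    by (auto simp: cantor_topology_def openin_pullback_topology)
  show "\<forall>x\<in>W. \<exists>m. \<forall>z. z \<inter> {..<m} = x \<inter> {..<m} \<longrightarrow> z \<in> W"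
  proof
    fix x assume "x \<in> W"
    then have "(\<lambda>n. n \<in> x) \<in> U" using U by simp
    then obtain V where V: "finite {i. V i \<noteq> (UNIV :: bool set)}" "(\<lambda>n. n \<in> x) \<in> Pi\<^sub>E UNIV V"
      "Pi\<^sub>E UNIV V \<subseteq> U"
      using U(1) unfolding openin_product_topology_alt by fastforce
    obtain m where m: "{i. V i \<noteq> UNIV} \<subseteq> {..<m}" using finite_nat_bounded[OF V(1)] by blast
    have "z \<in> W" if z: "z \<inter> {..<m} = x \<inter> {..<m}" for z
    proof -
      have "(i \<in> z) \<in> V i" for i
      proof (cases "i < m")
        case True
        then have "(i \<in> z) = (i \<in> x)" using z by blast
        moreover have "(i \<in> x) \<in> V i" using V(2) by (simp add: PiE_iff)
        ultimately show ?thesis by simp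
      next
        case False
        then have "V i = UNIV" using m by auto
        then show ?thesis by simp
      qed
      then have "(\<lambda>n. n \<in> z) \<in> Pi\<^sub>E UNIV V" by (simp add: PiE_iff)
      then show ?thesis using V(3) U(2) by auto
    qed
    then show "\<exists>m. \<forall>z. z \<inter> {..<m} = x \<inter> {..<m} \<longrightarrow> z \<in> W" by blast
  qed
next
  assume W: "\<forall>x\<in>W. \<exists>m. \<forall>z. z \<inter> {..<m} = x \<inter> {..<m} \<longrightarrow> z \<in> W"
  define U where "U = {p :: nat \<Rightarrow> bool. {n. p n} \<in> W}"
  have "openin (product_topology (\<lambda>_. discrete_topology (UNIV :: bool set)) (UNIV :: nat set)) U"
    unfolding openin_product_topology_alt
  proof
    fix p assume "p \<in> U"
    then obtain m where m: "\<And>z. z \<inter> {..<m} = {n. p n} \<inter> {..<m} \<Longrightarrow> z \<in> W"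
      using W unfolding U_def by blast
    define V where "V i = (if i < m then {p i} else UNIV)" for i
    have "finite {i \<in> UNIV. V i \<noteq> topspace (discrete_topology UNIV)}"
      by (rule finite_subset[of _ "{..<m}"]) (auto simp: V_def)
    moreover have "p \<in> Pi\<^sub>E UNIV V" by (auto simp: PiE_iff V_def)
    moreover have "Pi\<^sub>E UNIV V \<subseteq> U"
    proof
      fix q assume q: "q \<in> Pi\<^sub>E UNIV V"
      then have "q i = p i" if "i < m" for i
        using that PiE_mem[OF q, of i] by (simp add: V_def)
      then have "{n. q n} \<inter> {..<m} = {n. p n} \<inter> {..<m}" by auto
      then show "q \<in> U" using m by (auto simp: U_def)
    qed
    ultimately show "\<exists>V. finite {i \<in> UNIV. V i \<noteq> topspace (discrete_topology UNIV)} \<and>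
        (\<forall>i\<in>UNIV. openin (discrete_topology UNIV) (V i)) \<and> p \<in> Pi\<^sub>E UNIV V \<and> Pi\<^sub>E UNIV V \<subseteq> U"
      by auto
  qed
  moreover have "W = (\<lambda>A n. n \<in> A) -` U \<inter> UNIV" by (auto simp: U_def)
  ultimately show "openin cantor_topology W"
    unfolding cantor_topology_def openin_pullback_topology by blast
qed

section \<open>Clopen sets and their codes\<close>

lemma clopen_cantor:
  assumes "\<And>x z. x \<inter> {..<m} = z \<inter> {..<m} \<Longrightarrow> x \<in> W \<longleftrightarrow> z \<in> W"
  shows "openin cantor_topology W" "closedin cantor_topology W"
proof -
  show "openin cantor_topology W"
    unfolding openin_cantor_iff using assms by (intro ballI exI[of _ m] allI impI) blast
  have "openin cantor_topology (UNIV - W)"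
    unfolding openin_cantor_iff using assms by (intro ballI exI[of _ m] allI impI) blast
  then show "closedin cantor_topology W" by (simp add: closedin_def)
qed

lemma openin_cantor_subspace:
  "openin cantor_topology W \<Longrightarrow> openin (subtopology cantor_topology Y) (W \<inter> Y)"
  by (auto simp: openin_subtopology)

text \<open>These are the finite unions of cylinders, with initial segments listed as
  \<open>nat list\<close>. Number codes turn a sequence of covers into a
  \<open>nat \<Rightarrow> nat set\<close>, so there are only continuum many selection
  tasks.\<close>

definition clopen_set :: "nat \<Rightarrow> nat set set" where
  "clopen_set k = (case from_nat k :: nat \<times> nat list list of
     (m, T) \<Rightarrow> {z. z \<inter> {..<m} \<in> set ` set T})"

lemma clopen_set_open:
  assumes "t \<in> clopen_set k"
  shows "\<exists>m. \<forall>z. z \<inter> {..<m} = t \<inter> {..<m} \<longrightarrow> z \<in> clopen_set k"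
proof -
  obtain m T where mT: "(from_nat k :: nat \<times> nat list list) = (m, T)" by fastforce
  have "clopen_set k = {z. z \<inter> {..<m} \<in> set ` set T}" by (simp add: clopen_set_def mT)
  then show ?thesis using assms by (metis mem_Collect_eq)
qed

text \<open>Finitely many neighbourhoods can be cut at a common length \<open>M\<close>; the
  cylinders of that length around the points of \<open>F\<close> stay inside \<open>W\<close>. Hence
  coded sets can replace arbitrary open sets in \<open>n\<close>-covers.\<close>

lemma clopen_set_between:
  assumes "finite F" "F \<subseteq> W" and W: "openin cantor_topology W"
  shows "\<exists>k. F \<subseteq> clopen_set k \<and> clopen_set k \<subseteq> W"
proof -
  have "\<forall>x\<in>F. \<exists>m. \<forall>z. z \<inter> {..<m} = x \<inter> {..<m} \<longrightarrow> z \<in> W"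
    using assms unfolding openin_cantor_iff by blast
  then obtain m where m: "\<And>x z. x \<in> F \<Longrightarrow> z \<inter> {..<m x} = x \<inter> {..<m x} \<Longrightarrow> z \<in> W"
    by metis
  define M where "M = Max (insert 0 (m ` F))"
  have M: "m x \<le> M" if "x \<in> F" for x
    using that assms(1) by (auto simp: M_def)
  obtain xs where xs: "set xs = F" using finite_list[OF assms(1)] by blast
  define T where "T = map (\<lambda>x. sorted_list_of_set (x \<inter> {..<M})) xs"
  have T: "set ` set T = (\<lambda>x. x \<inter> {..<M}) ` F"
    by (simp add: T_def xs image_image)
  have eq: "clopen_set (to_nat (M, T)) = {z. z \<inter> {..<M} \<in> (\<lambda>x. x \<inter> {..<M}) ` F}"
    by (simp add: clopen_set_def T)
  have "z \<in> W" if x: "x \<in> F" and z: "z \<inter> {..<M} = x \<inter> {..<M}" for x z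
  proof (rule m[OF x])
    have "z \<inter> {..<M} \<inter> {..<m x} = x \<inter> {..<M} \<inter> {..<m x}" using z by simp
    moreover have "{..<M} \<inter> {..<m x} = {..<m x}" using M[OF x] by auto
    ultimately show "z \<inter> {..<m x} = x \<inter> {..<m x}" by (simp add: Int_assoc)
  qed
  then have "clopen_set (to_nat (M, T)) \<subseteq> W" unfolding eq by auto
  moreover have "F \<subseteq> clopen_set (to_nat (M, T))" unfolding eq by auto
  ultimately show ?thesis by blast
qed

section \<open>A tower that meets every selection task\<close>

lemma sparse_infinite_subset:
  fixes g :: "nat \<Rightarrow> nat"
  assumes "infinite a"
  obtains z where "z \<subseteq> a" "infinite z" "\<And>n. card (z \<inter> {..g n}) \<le> n"
proof -
  \<comment> \<open>The sum puts \<open>e i\<close> above every \<open>g n\<close> with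
    \<open>n \<le> i\<close>, so only \<open>e 0, ..., e (n - 1)\<close> can be at most
    \<open>g n\<close>; the summand \<open>i\<close> makes the range unbounded.\<close>
  have "\<exists>e\<in>a. i + (\<Sum>j\<le>i. g j) < e" for i
    using assms unfolding infinite_nat_iff_unbounded by blast
  then obtain e where e: "\<And>i. e i \<in> a" "\<And>i. i + (\<Sum>j\<le>i. g j) < e i" by metis
  have less: "g n < e i" if "n \<le> i" for n i
  proof -
    have "g n \<le> (\<Sum>j\<le>i. g j)" using that by (intro member_le_sum) auto
    then show ?thesis using e(2)[of i] by simp
  qed
  show thesis
  proof
    show "range e \<subseteq> a" using e by auto
    have "i < e i" for i using e(2)[of i] by simp
    then show "infinite (range e)" unfolding infinite_nat_iff_unbounded by blast
    fix n
    have "range e \<inter> {..g n} \<subseteq> e ` {..<n}"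
    proof
      fix x assume "x \<in> range e \<inter> {..g n}"
      then obtain i where i: "x = e i" "e i \<le> g n" by auto
      then have "i < n" using less[of n i] by linarith
      then show "x \<in> e ` {..<n}" using i by blast
    qed
    then have "card (range e \<inter> {..g n}) \<le> card (e ` {..<n})" by (intro card_mono) auto
    also have "\<dots> \<le> n" using card_image_le[of "{..<n}" e] by simp
    finally show "card (range e \<inter> {..g n}) \<le> n" .
  qed
qed

text \<open>The coded counterpart of a sequence whose \<open>n\<close>-th term is an
  \<open>n\<close>-cover of \<open>Y\<close>.\<close>

definition finitely_covering :: "(nat \<Rightarrow> nat set) \<Rightarrow> nat set set \<Rightarrow> bool" where
  "finitely_covering W Y \<longleftrightarrow>
     (\<forall>n H. H \<subseteq> Y \<and> finite H \<and> card H \<le> n \<longrightarrow> (\<exists>k\<in>W n. H \<subseteq> clopen_set k))"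

text \<open>One stage of the recursion: \<open>z\<close> is a sparse subset of the
  pseudo-intersection \<open>a\<close>, so a set almost contained in \<open>z\<close> is almost
  contained in \<open>a\<close> and is eventually selected.\<close>

lemma tower_step:
  fixes g :: "nat \<Rightarrow> nat"
  assumes MA: Martins_Axiom and C: "C \<prec> (UNIV :: real set)"
    and centered: "\<And>H. H \<subseteq> C \<Longrightarrow> finite H \<Longrightarrow> infinite (\<Inter>H)"
  shows "\<exists>z. infinite z \<and> (\<forall>x\<in>C. finite (z - x)) \<and> (\<forall>n. card (z \<inter> {..g n}) \<le> n) \<and>
    (finitely_covering W (C \<union> Fin) \<longrightarrow> (\<exists>v. (\<forall>n. v n \<in> W n) \<and>
       (\<forall>x\<in>C. \<forall>\<^sub>\<infinity>n. x \<in> clopen_set (v n)) \<and>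
       (\<forall>y. finite (y - z) \<longrightarrow> (\<forall>\<^sub>\<infinity>n. y \<in> clopen_set (v n)))))"
proof -
  define W' where "W' = (if finitely_covering W (C \<union> Fin) then W else (\<lambda>_. UNIV))"
  have W': "\<exists>k\<in>W' n. H \<subseteq> clopen_set k" if "H \<subseteq> C \<union> Fin" "finite H" "card H \<le> n" for H n
    using that clopen_set_between[OF that(2) subset_UNIV]
    by (auto simp: W'_def finitely_covering_def openin_cantor_iff)
  interpret cover_selection clopen_set W' C
    using clopen_set_open W' centered by (rule cover_selection.intro)
  obtain v a where va: "\<And>n. v n \<in> W' n" "infinite a" "\<And>x. x \<in> C \<Longrightarrow> finite (a - x)"
    "\<And>x. x \<in> C \<Longrightarrow> \<forall>\<^sub>\<infinity>n. x \<in> clopen_set (v n)"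
    "\<And>y. finite (y - a) \<Longrightarrow> \<forall>\<^sub>\<infinity>n. y \<in> clopen_set (v n)"
    using selection_with_pseudo_intersection[OF MA C] by blast
  obtain z where z: "z \<subseteq> a" "infinite z" "\<And>n. card (z \<inter> {..g n}) \<le> n"
    using sparse_infinite_subset[OF va(2)] by blast
  have "finite (z - x)" if "x \<in> C" for x
    by (rule finite_subset[OF _ va(3)[OF that]]) (use z in auto)
  moreover have "\<forall>\<^sub>\<infinity>n. y \<in> clopen_set (v n)" if "finite (y - z)" for y
  proof (rule va(5))
    show "finite (y - a)" by (rule finite_subset[OF _ that]) (use z in auto)
  qed
  moreover have "\<forall>n. v n \<in> W n" if "finitely_covering W (C \<union> Fin)"
    using va(1) that by (simp add: W'_def)
  ultimately show ?thesis using z(2,3) va(4) by (intro exI[of _ z]) blast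
qed

lemma tasks_lepoll_real: "(UNIV :: ((nat \<Rightarrow> nat set) \<times> (nat \<Rightarrow> nat)) set) \<lesssim> (UNIV :: real set)"
proof -
  define code where "code = (\<lambda>(W :: nat \<Rightarrow> nat set, g :: nat \<Rightarrow> nat) i :: nat.
    if even i then W (i div 2) else {g (i div 2)})"
  have "inj code"
  proof (rule injI, clarify)
    fix W W' :: "nat \<Rightarrow> nat set" and g g' :: "nat \<Rightarrow> nat"
    assume eq: "code (W, g) = code (W', g')"
    have "W i = W' i" "g i = g' i" for i
      using fun_cong[OF eq, of "2 * i"] fun_cong[OF eq, of "Suc (2 * i)"] by (auto simp: code_def)
    then show "W = W' \<and> g = g'" by blast
  qed
  then have "(UNIV :: ((nat \<Rightarrow> nat set) \<times> (nat \<Rightarrow> nat)) set) \<lesssim> (UNIV :: (nat \<Rightarrow> nat set) set)"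
    unfolding lepoll_def by blast
  then show ?thesis using lepoll_trans nat_set_sequences_lepoll_real by blast
qed

text \<open>Recursion along a well-order of the reals whose proper initial segments are smaller than
  the continuum, with every pair of a coded cover sequence and a function \<open>g\<close> treated
  at some stage. A sequence covering the whole tower covers the part built before its stage, so its
  task was met there.\<close>

theorem selective_tower:
  assumes MA: Martins_Axiom
  obtains T :: "nat set set" where
    "\<And>x. x \<in> T \<Longrightarrow> infinite x"
    "\<And>x y. x \<in> T \<Longrightarrow> y \<in> T \<Longrightarrow> finite (x - y) \<or> finite (y - x)"
    "\<And>g :: nat \<Rightarrow> nat. \<exists>x\<in>T. \<forall>n. card (x \<inter> {..g n}) \<le> n"
    "\<And>W. finitely_covering W (T \<union> Fin) \<Longrightarrow>
       \<exists>v. (\<forall>n. v n \<in> W n) \<and> (\<forall>x\<in>T \<union> Fin. \<forall>\<^sub>\<infinity>n. x \<in> clopen_set (v n))"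
proof -
  include cardinal_syntax
  obtain code :: "(nat \<Rightarrow> nat set) \<times> (nat \<Rightarrow> nat) \<Rightarrow> real" where code: "inj code"
    using tasks_lepoll_real by (auto simp: lepoll_def)
  define task where "task = inv code"
  have task: "\<exists>\<alpha>. task \<alpha> = (W, g)" for W g
    using inv_f_f[OF code] by (auto simp: task_def)
  define R where "R = |UNIV :: real set| - Id"
  have wo: "well_order_on UNIV |UNIV :: real set|" by (rule card_of_well_order_on)
  have wf: "wf R" using wo by (simp add: R_def well_order_on_def)
  have lin: "(\<alpha>, \<beta>) \<in> R \<or> \<alpha> = \<beta> \<or> (\<beta>, \<alpha>) \<in> R" for \<alpha> \<beta>
    using wo by (auto simp: R_def well_order_on_def linear_order_on_def total_on_def)
  have trans: "trans R"
    using wo by (auto simp: R_def well_order_on_def linear_order_on_def partial_order_on_def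
        preorder_on_def intro: trans_diff_Id)
  have small: "{\<beta>. (\<beta>, \<alpha>) \<in> R} \<prec> (UNIV :: real set)" for \<alpha>
  proof -
    have "{\<beta>. (\<beta>, \<alpha>) \<in> R} = underS |UNIV :: real set| \<alpha>" by (auto simp: R_def underS_def)
    then show ?thesis
      using card_of_underS[OF card_of_Card_order, of \<alpha> "UNIV :: real set"]
      by (simp add: lesspoll_iff_card_of_ordLess Field_card_of)
  qed
  \<comment> \<open>\<open>f\<close> enters only through its values at predecessors of
    \<open>\<alpha>\<close>, as the well-founded choice principle demands.\<close>
  define good where "good f \<alpha> z \<longleftrightarrow> infinite z \<and>
     (\<forall>x \<in> f ` {\<beta>. (\<beta>, \<alpha>) \<in> R}. finite (z - x)) \<and>
     (\<forall>n. card (z \<inter> {..snd (task \<alpha>) n}) \<le> n) \<and>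
     (finitely_covering (fst (task \<alpha>)) (f ` {\<beta>. (\<beta>, \<alpha>) \<in> R} \<union> Fin) \<longrightarrow>
       (\<exists>v. (\<forall>n. v n \<in> fst (task \<alpha>) n) \<and>
         (\<forall>x\<in>f ` {\<beta>. (\<beta>, \<alpha>) \<in> R}. \<forall>\<^sub>\<infinity>n. x \<in> clopen_set (v n)) \<and>
         (\<forall>y. finite (y - z) \<longrightarrow> (\<forall>\<^sub>\<infinity>n. y \<in> clopen_set (v n)))))"
    for f :: "real \<Rightarrow> nat set" and \<alpha> z
  have "\<exists>f. \<forall>\<alpha>. good f \<alpha> (f \<alpha>)"
  proof (rule dependent_wf_choice[OF wf])
    fix f h :: "real \<Rightarrow> nat set" and \<alpha> z
    assume "\<And>\<beta>. (\<beta>, \<alpha>) \<in> R \<Longrightarrow> f \<beta> = h \<beta>"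
    then have "f ` {\<beta>. (\<beta>, \<alpha>) \<in> R} = h ` {\<beta>. (\<beta>, \<alpha>) \<in> R}" by (auto intro: image_cong)
    then show "good f \<alpha> z = good h \<alpha> z" by (simp only: good_def)
  next
    fix \<alpha> and f :: "real \<Rightarrow> nat set"
    assume IH: "\<And>\<beta>. (\<beta>, \<alpha>) \<in> R \<Longrightarrow> good f \<beta> (f \<beta>)"
    let ?C = "f ` {\<beta>. (\<beta>, \<alpha>) \<in> R}"
    have "?C \<prec> (UNIV :: real set)" using small image_lepoll lesspoll_trans1 by blast
    moreover have "infinite (\<Inter>H)" if H: "H \<subseteq> ?C" "finite H" for H
    proof -
      obtain J where J: "J \<subseteq> {\<beta>. (\<beta>, \<alpha>) \<in> R}" "finite J" "H = f ` J"
        using finite_subset_image[OF H(2,1)] by blast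
      have "\<exists>z. infinite z \<and> (\<forall>\<beta>\<in>J. finite (z - f \<beta>))"
      proof (cases "J = {}")
        case False
        \<comment> \<open>The member with the largest index in \<open>J\<close> is almost contained
          in the others, which gives centeredness.\<close>
        have "\<exists>\<gamma>\<in>J. \<forall>\<beta>\<in>J. \<beta> = \<gamma> \<or> (\<beta>, \<gamma>) \<in> R"
          using J(2) False
        proof (induction J rule: finite_ne_induct)
          case (insert \<beta> J)
          then obtain \<gamma> where "\<gamma> \<in> J" "\<forall>\<beta>\<in>J. \<beta> = \<gamma> \<or> (\<beta>, \<gamma>) \<in> R" by blast
          then show ?case using lin[of \<beta> \<gamma>] trans by (auto dest: transD)
        qed auto
        then obtain \<gamma> where \<gamma>: "\<gamma> \<in> J" "\<And>\<beta>. \<beta> \<in> J \<Longrightarrow> \<beta> = \<gamma> \<or> (\<beta>, \<gamma>) \<in> R" by blast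
        have "good f \<gamma> (f \<gamma>)" using IH J(1) \<gamma>(1) by blast
        then have "infinite (f \<gamma>)" "\<And>\<beta>. (\<beta>, \<gamma>) \<in> R \<Longrightarrow> finite (f \<gamma> - f \<beta>)"
          unfolding good_def by blast+
        then show ?thesis using \<gamma>(2) by (metis Diff_cancel finite.emptyI)
      qed (auto intro: exI[of _ UNIV])
      then obtain z where z: "infinite z" "\<And>\<beta>. \<beta> \<in> J \<Longrightarrow> finite (z - f \<beta>)" by blast
      have "z \<subseteq> \<Inter>H \<union> (\<Union>\<beta>\<in>J. z - f \<beta>)" using J(3) by auto
      moreover have "finite (\<Union>\<beta>\<in>J. z - f \<beta>)" using J(2) z(2) by blast
      ultimately show ?thesis using z(1) by (meson finite_UnI finite_subset)
    qed
    ultimately show "\<exists>z. good f \<alpha> z"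
      unfolding good_def by (rule tower_step[OF MA])
  qed
  then obtain f where good: "\<And>\<alpha>. good f \<alpha> (f \<alpha>)" by blast
  have inf: "infinite (f \<alpha>)" and dec: "(\<beta>, \<alpha>) \<in> R \<Longrightarrow> finite (f \<alpha> - f \<beta>)"
    and sparse: "card (f \<alpha> \<inter> {..snd (task \<alpha>) n}) \<le> n" for \<alpha> \<beta> n
    using good[of \<alpha>] unfolding good_def by blast+
  show thesis
  proof (rule that[of "range f"])
    show "infinite x" if "x \<in> range f" for x using that inf by blast
    show "finite (x - y) \<or> finite (y - x)" if xy: "x \<in> range f" "y \<in> range f" for x y
    proof -
      obtain \<alpha> \<beta> where "x = f \<alpha>" "y = f \<beta>" using xy by blast
      then show ?thesis using lin[of \<alpha> \<beta>] dec[of \<alpha> \<beta>] dec[of \<beta> \<alpha>] by auto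
    qed
    show "\<exists>x\<in>range f. \<forall>n. card (x \<inter> {..g n}) \<le> n" for g
    proof -
      obtain \<alpha> where "task \<alpha> = (\<lambda>_. {}, g)" using task by blast
      then show ?thesis using sparse[of \<alpha>] by auto
    qed
    show "\<exists>v. (\<forall>n. v n \<in> W n) \<and> (\<forall>x\<in>range f \<union> Fin. \<forall>\<^sub>\<infinity>n. x \<in> clopen_set (v n))"
      if W: "finitely_covering W (range f \<union> Fin)" for W
    proof -
      obtain \<alpha> where \<alpha>: "task \<alpha> = (W, \<lambda>_. 0)" using task by blast
      have "f ` {\<beta>. (\<beta>, \<alpha>) \<in> R} \<union> Fin \<subseteq> range f \<union> Fin" by blast
      then have cov: "finitely_covering W (f ` {\<beta>. (\<beta>, \<alpha>) \<in> R} \<union> Fin)"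
        using W unfolding finitely_covering_def by (meson subset_trans)
      obtain v where v: "\<And>n. v n \<in> W n"
        "\<And>\<beta>. (\<beta>, \<alpha>) \<in> R \<Longrightarrow> \<forall>\<^sub>\<infinity>n. f \<beta> \<in> clopen_set (v n)"
        "\<And>y. finite (y - f \<alpha>) \<Longrightarrow> \<forall>\<^sub>\<infinity>n. y \<in> clopen_set (v n)"
        using good[of \<alpha>, unfolded good_def \<alpha> fst_conv, THEN conjunct2, THEN conjunct2,
            THEN conjunct2, THEN mp, OF cov]
        by auto
      \<comment> \<open>Members before stage \<open>\<alpha>\<close> were selected explicitly; the
        member at \<open>\<alpha>\<close> and all later ones are almost contained in
        \<open>f \<alpha>\<close>.\<close>
      have "\<forall>\<^sub>\<infinity>n. f \<beta> \<in> clopen_set (v n)" for \<beta>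
        using lin[of \<beta> \<alpha>] v(2)[of \<beta>] v(3)[of "f \<beta>"] dec[of \<alpha> \<beta>] by auto
      moreover have "\<forall>\<^sub>\<infinity>n. y \<in> clopen_set (v n)" if "y \<in> Fin" for y
        using that v(3) by (simp add: Fin_def)
      ultimately show ?thesis using v(1) by blast
    qed
  qed
qed

section \<open>The covering properties\<close>

text \<open>Passes from covers to codes of clopen sets whose trace on \<open>X\<close> refines them,
  selects there, and returns to members of the covers. Eventual membership is the
  \<open>\<gamma>\<close> property.\<close>

lemma strong_gamma_setI:
  assumes sel: "\<And>W. finitely_covering W X \<Longrightarrow>
       \<exists>v. (\<forall>n. v n \<in> W n) \<and> (\<forall>x\<in>X. \<forall>\<^sub>\<infinity>n. x \<in> clopen_set (v n))"
  shows "strong_gamma_set (subtopology cantor_topology X)"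
  unfolding strong_gamma_set_def
proof (intro allI impI)
  fix \<U> :: "nat \<Rightarrow> nat set set set"
  assume \<U>: "\<forall>n. n_cover (subtopology cantor_topology X) n (\<U> n) \<and>
    nontrivial_cover (subtopology cantor_topology X) (\<U> n)"
  have op: "openin (subtopology cantor_topology X) U" if "U \<in> \<U> n" for U n
    using \<U> that by (auto simp: n_cover_def open_cover_def)
  define W where "W n = {k. \<exists>U\<in>\<U> n. clopen_set k \<inter> X \<subseteq> U}" for n
  have "finitely_covering W X"
    unfolding finitely_covering_def
  proof (intro allI impI, elim conjE)
    fix n H assume H: "H \<subseteq> X" "finite H" "card H \<le> n"
    then obtain U where U: "U \<in> \<U> n" "H \<subseteq> U"
      using \<U> unfolding n_cover_def by (metis Int_UNIV_left topspace_cantor topspace_subtopology)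
    obtain V where V: "openin cantor_topology V" "U = V \<inter> X"
      using op[OF U(1)] by (auto simp: openin_subtopology)
    then obtain k where "H \<subseteq> clopen_set k" "clopen_set k \<subseteq> V"
      using clopen_set_between[OF H(2) _ V(1)] U(2) by blast
    then show "\<exists>k\<in>W n. H \<subseteq> clopen_set k" using U V unfolding W_def by blast
  qed
  then obtain v where v: "\<And>n. v n \<in> W n" "\<And>x. x \<in> X \<Longrightarrow> \<forall>\<^sub>\<infinity>n. x \<in> clopen_set (v n)"
    using sel by blast
  obtain U where U: "\<And>n. U n \<in> \<U> n" "\<And>n. clopen_set (v n) \<inter> X \<subseteq> U n"
    using v(1) unfolding W_def by simp metis
  have ev: "\<forall>\<^sub>\<infinity>n. x \<in> U n" if "x \<in> X" for x
    using v(2)[OF that] by (rule MOST_mono) (use U(2) that in blast)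
  have nontriv: "\<not> X \<subseteq> U n" for n
    using \<U> U(1) by (auto simp: nontrivial_cover_def)
  \<comment> \<open>With finite range, one member would be chosen infinitely often; every point lies
    in almost all chosen sets, so this member would contain \<open>X\<close>.\<close>
  have "infinite (range U)"
  proof
    assume "finite (range U)"
    then obtain n where "infinite {m. U m = U n}"
      using inf_img_fin_dom[of U UNIV] by (auto simp: vimage_def)
    then have "\<exists>\<^sub>\<infinity>m. U m = U n" by (simp add: frequently_cofinite)
    then have "x \<in> U n" if "x \<in> X" for x
      using ev[OF that] by (metis (mono_tags, lifting) INFM_E INFM_conjI)
    then show False using nontriv by blast
  qed
  moreover have "\<Union>(range U) = X"
  proof
    show "\<Union>(range U) \<subseteq> X" using openin_subset[OF op[OF U(1)]] by auto
    show "X \<subseteq> \<Union>(range U)"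
    proof
      fix x assume "x \<in> X"
      then have "\<exists>n. x \<in> U n" using ev[of x] by (metis MOST_nat_le order_refl)
      then show "x \<in> \<Union>(range U)" by blast
    qed
  qed
  moreover have "finite {V \<in> range U. x \<notin> V}" if "x \<in> X" for x
  proof -
    have "finite {n. x \<notin> U n}" using ev[OF that] by (simp add: eventually_cofinite)
    then show ?thesis by (rule finite_subset[rotated, OF finite_imageI[of _ U]]) auto
  qed
  ultimately have "gamma_cover (subtopology cantor_topology X) (range U)"
    using op[OF U(1)] nontriv
    by (auto simp: gamma_cover_def open_cover_def nontrivial_cover_def)
  then show "\<exists>U. (\<forall>n. U n \<in> \<U> n) \<and> gamma_cover (subtopology cantor_topology X) (range U)"
    using U(1) by blast
qed

text \<open>\<open>sparse\<close> is domination in terms of counting: the element number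
  \<open>n + 1\<close> of \<open>x\<close> exceeds \<open>g n\<close>.\<close>

locale sparse_tower =
  fixes T :: "nat set set"
  assumes infinite_mem: "x \<in> T \<Longrightarrow> infinite x"
    and almost_linear: "x \<in> T \<Longrightarrow> y \<in> T \<Longrightarrow> finite (x - y) \<or> finite (y - x)"
    and sparse: "\<exists>x\<in>T. \<forall>n. card (x \<inter> {..g n}) \<le> (n :: nat)"
begin

text \<open>Sparseness for a constant function at \<open>n = 0\<close>; it makes both covers below
  nontrivial.\<close>

lemma mem_disjoint_atMost: "\<exists>x\<in>T. x \<inter> {..k} = {}"
proof -
  obtain x where "x \<in> T" "card (x \<inter> {..k}) \<le> 0" using sparse[of "\<lambda>_. k"] by blast
  then show ?thesis by auto
qed

text \<open>The sets \<open>V n k\<close> increase with \<open>k\<close>, so a finite choice from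
  the \<open>n\<close>-th cover lies in a single \<open>V n (g n)\<close>. A member of
  \<open>T\<close> that is sparse for this \<open>g\<close> escapes all of them.\<close>

lemma not_Menger: "\<not> Ufin (subtopology cantor_topology T)
  (gamma_covers (subtopology cantor_topology T)) (open_covers (subtopology cantor_topology T))"
proof
  define V where "V n k = {x. n < card (x \<inter> {..k})} \<inter> T" for n k :: nat
  have V_mono: "V n k \<subseteq> V n l" if "k \<le> l" for n k l
  proof -
    have "card (x \<inter> {..k}) \<le> card (x \<inter> {..l})" for x
      using that by (intro card_mono) auto
    then show ?thesis unfolding V_def using order_less_le_trans by blast
  qed
  have V_open: "openin (subtopology cantor_topology T) (V n k)" for n k
    unfolding V_def
  proof (intro openin_cantor_subspace clopen_cantor)
    fix x z assume "x \<inter> {..<Suc k} = z \<inter> {..<Suc k}"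
    then show "x \<in> {x. n < card (x \<inter> {..k})} \<longleftrightarrow> z \<in> {x. n < card (x \<inter> {..k})}"
      by (simp add: lessThan_Suc_atMost)
  qed
  have V_large: "\<exists>k. x \<in> V n k" if x: "x \<in> T" for x n
  proof -
    obtain A where A: "A \<subseteq> x" "finite A" "card A = Suc n"
      using infinite_arbitrarily_large[OF infinite_mem[OF x]] by blast
    obtain k where "A \<subseteq> {..k}" using A(2) by (meson finite_nat_iff_bounded_le)
    then have "card A \<le> card (x \<inter> {..k})" using A(1) by (intro card_mono) auto
    then have "x \<in> V n k" using A(3) x by (simp add: V_def)
    then show ?thesis by blast
  qed
  have V_bound: "\<exists>k. \<Union>\<F> \<subseteq> V n k" if \<F>: "finite \<F>" "\<F> \<subseteq> range (V n)" for \<F> n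
  proof -
    obtain K where K: "finite K" "\<F> = V n ` K" using finite_subset_image[OF \<F>] by blast
    obtain k where "K \<subseteq> {..k}" using K(1) by (meson finite_nat_iff_bounded_le)
    then have "V n i \<subseteq> V n k" if "i \<in> K" for i using that by (intro V_mono) auto
    then have "\<Union>\<F> \<subseteq> V n k" using K(2) by blast
    then show ?thesis by blast
  qed
  have V_proper: "\<not> T \<subseteq> V n k" for n k
    using mem_disjoint_atMost[of k] by (force simp: V_def)
  have V_cover: "\<Union>(range (V n)) = T" for n
    using V_large by (auto simp: V_def)
  have no_fin: "\<Union>\<F> \<noteq> T" if "finite \<F>" "\<F> \<subseteq> range (V n)" for \<F> n
    using V_bound[OF that] V_proper by metis
  have V_gamma: "range (V n) \<in> gamma_covers (subtopology cantor_topology T)" for n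
  proof -
    have "finite {U \<in> range (V n). x \<notin> U}" if x: "x \<in> T" for x
    proof -
      obtain k where k: "x \<in> V n k" using V_large[OF x] by blast
      have "l < k" if "x \<notin> V n l" for l
        using that k V_mono[of k l n] by (meson not_le subsetD)
      then have "{U \<in> range (V n). x \<notin> U} \<subseteq> V n ` {..<k}" by blast
      then show ?thesis by (rule finite_subset) simp
    qed
    moreover have "infinite (range (V n))" using no_fin V_cover by blast
    ultimately show ?thesis
      using V_open V_cover V_proper
      by (auto simp: gamma_covers_def gamma_cover_def open_cover_def nontrivial_cover_def)
  qed
  assume "Ufin (subtopology cantor_topology T) (gamma_covers (subtopology cantor_topology T))
    (open_covers (subtopology cantor_topology T))"
  then obtain \<F> where \<F>: "\<And>n. finite (\<F> n) \<and> \<F> n \<subseteq> range (V n)"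
    "range (\<lambda>n. \<Union>(\<F> n)) \<in> open_covers (subtopology cantor_topology T)"
    unfolding Ufin_def using V_gamma no_fin
    by (elim allE[of _ "\<lambda>n. range (V n)"]) auto
  have "\<forall>n. \<exists>k. \<Union>(\<F> n) \<subseteq> V n k" using V_bound \<F>(1) by blast
  then obtain g where g: "\<And>n. \<Union>(\<F> n) \<subseteq> V n (g n)" by metis
  obtain x where x: "x \<in> T" "\<And>n. card (x \<inter> {..g n}) \<le> n" using sparse by blast
  have "(\<Union>n. \<Union>(\<F> n)) = T" using \<F>(2) by (simp add: open_covers_def open_cover_def)
  then obtain n where "x \<in> \<Union>(\<F> n)" using x(1) by blast
  then have "n < card (x \<inter> {..g n})" using g[of n] by (auto simp: V_def)
  then show False using x(2)[of n] by simp
qed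

text \<open>Almost linearity gives the \<open>\<tau>\<close> condition. A
  \<open>\<gamma>\<close>-subcover indexed by \<open>A\<close> would make \<open>A\<close> a
  pseudo-intersection of \<open>T\<close>, which a member sparser than \<open>A\<close>
  refutes.\<close>

lemma not_tau_set: "\<not> tau_set (subtopology cantor_topology T)"
proof
  define U where "U n = {x. n \<in> x} \<inter> T" for n :: nat
  have clopen: "openin cantor_topology {x. n \<in> x}" "closedin cantor_topology {x. n \<in> x}"
    for n :: nat
    by (rule clopen_cantor[where m = "Suc n"]; blast)+
  have U_open: "openin (subtopology cantor_topology T) (U n)" for n
    unfolding U_def by (intro openin_cantor_subspace clopen)
  have U_closed: "closedin (subtopology cantor_topology T) (U n)" for n
    unfolding U_def closedin_subtopology using clopen by blast
  have U_cover: "\<Union>(range U) = T"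
    using infinite_mem by (fastforce simp: U_def dest: infinite_imp_nonempty)
  have U_proper: "\<not> T \<subseteq> U n" for n
    using mem_disjoint_atMost[of n] by (auto simp: U_def)
  have U_inf: "infinite {V \<in> range U. x \<in> V}" if x: "x \<in> T" for x
  proof
    assume "finite {V \<in> range U. x \<in> V}"
    moreover have "{V \<in> range U. x \<in> V} = U ` x" using x by (auto simp: U_def)
    ultimately have "finite (U ` x)" by simp
    \<comment> \<open>\<open>U\<close> might identify indices, so infinity of \<open>x\<close> alone
      does not suffice. A \<open>y\<close> in \<open>T\<close> disjoint from the finite set
      \<open>N\<close> of representatives is disjoint from \<open>x\<close>, contradicting almost
      linearity.\<close>
    then obtain N where N: "N \<subseteq> x" "finite N" "U ` x = U ` N"
      by (metis finite_subset_image subset_refl)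
    obtain k where k: "N \<subseteq> {..k}" using N(2) by (meson finite_nat_iff_bounded_le)
    obtain y where y: "y \<in> T" "y \<inter> {..k} = {}" using mem_disjoint_atMost by blast
    have "n \<notin> y" if "n \<in> x" for n
    proof
      assume "n \<in> y"
      have "U n \<in> U ` N" unfolding N(3)[symmetric] using that by (rule imageI)
      then obtain n' where "n' \<in> N" "U n = U n'" by blast
      then have "n' \<in> y" using \<open>n \<in> y\<close> y(1) by (auto simp: U_def)
      then show False using \<open>n' \<in> N\<close> k y(2) by blast
    qed
    then have "x - y = x" "y - x = y" by auto
    then show False using almost_linear[OF x y(1)] infinite_mem x y(1) by auto
  qed
  have fin_diff: "finite {V \<in> range U. x \<in> V \<and> y \<notin> V}" if "finite (x - y)" "x \<in> T" "y \<in> T" for x y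
    by (rule finite_subset[OF _ finite_imageI[OF that(1), of U]]) (use that in \<open>auto simp: U_def\<close>)
  have "finite {V \<in> range U. x \<in> V \<and> y \<notin> V} \<or> finite {V \<in> range U. y \<in> V \<and> x \<notin> V}"
    if "x \<in> T" "y \<in> T" for x y
    using almost_linear[OF that] fin_diff that by blast
  then have "tau_cover (subtopology cantor_topology T) (range U)"
    using U_open U_cover U_proper U_inf
    by (simp add: tau_cover_def open_cover_def nontrivial_cover_def)
  moreover assume "tau_set (subtopology cantor_topology T)"
  ultimately obtain \<V> where \<V>: "\<V> \<subseteq> range U" "gamma_cover (subtopology cantor_topology T) \<V>"
    unfolding tau_set_def using U_closed by blast
  \<comment> \<open>One index per member of the subcover, so finiteness can be pulled back from sets
    to indices.\<close>
  obtain A where A: "inj_on U A" "\<V> = U ` A"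
    using \<V>(1) unfolding subset_image_inj by blast
  have "infinite A" using \<V>(2) A(2) by (auto simp: gamma_cover_def)
  have A_diff: "finite (A - x)" if "x \<in> T" for x
  proof -
    have "finite {V \<in> \<V>. x \<notin> V}" using \<V>(2) that by (auto simp: gamma_cover_def)
    then have "finite (U ` (A - x))"
      by (rule finite_subset[rotated]) (auto simp: A(2) U_def)
    then show ?thesis using A(1) by (meson Diff_subset finite_imageD inj_on_subset)
  qed
  have "\<exists>k. 2 * n \<le> card (A \<inter> {..k})" for n
  proof -
    obtain N where N: "N \<subseteq> A" "finite N" "card N = 2 * n"
      using infinite_arbitrarily_large[OF \<open>infinite A\<close>] by blast
    obtain k where "N \<subseteq> {..k}" using N(2) by (meson finite_nat_iff_bounded_le)
    then have "card N \<le> card (A \<inter> {..k})" using N(1) by (intro card_mono) auto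
    then show ?thesis using N(3) by auto
  qed
  then obtain g where g: "\<And>n. 2 * n \<le> card (A \<inter> {..g n})" by metis
  obtain x where x: "x \<in> T" "\<And>n. card (x \<inter> {..g n}) \<le> n" using sparse by blast
  \<comment> \<open>With \<open>n\<close> above \<open>card (A - x)\<close>, at most
    \<open>card (A - x) + n < 2 * n\<close> elements of \<open>A\<close> lie in
    \<open>{..g n}\<close>, against the choice of \<open>g\<close>.\<close>
  define n where "n = Suc (card (A - x))"
  have "A \<inter> {..g n} \<subseteq> (A - x) \<union> (x \<inter> {..g n})" by blast
  then have "card (A \<inter> {..g n}) \<le> card ((A - x) \<union> (x \<inter> {..g n}))"
    using A_diff[OF x(1)] by (intro card_mono) auto
  also have "\<dots> \<le> card (A - x) + card (x \<inter> {..g n})" by (rule card_Un_le)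
  also have "\<dots> < 2 * n" using x(2)[of n] by (simp add: n_def)
  finally show False using g[of n] by simp
qed

end

theorem theorem3p3:
  assumes "Martins_Axiom"
  shows "\<exists>X :: nat set set.
    strong_gamma_set (subtopology cantor_topology X) \<and>
    \<not> Ufin (subtopology cantor_topology (X - Fin))
         (gamma_covers (subtopology cantor_topology (X - Fin)))
         (open_covers (subtopology cantor_topology (X - Fin))) \<and>
    \<not> tau_set (subtopology cantor_topology (X - Fin))"
proof -
  obtain T :: "nat set set" where T: "\<And>x. x \<in> T \<Longrightarrow> infinite x"
    "\<And>x y. x \<in> T \<Longrightarrow> y \<in> T \<Longrightarrow> finite (x - y) \<or> finite (y - x)"
    "\<And>g :: nat \<Rightarrow> nat. \<exists>x\<in>T. \<forall>n. card (x \<inter> {..g n}) \<le> n"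
    and sel: "\<And>W. finitely_covering W (T \<union> Fin) \<Longrightarrow>
       \<exists>v. (\<forall>n. v n \<in> W n) \<and> (\<forall>x\<in>T \<union> Fin. \<forall>\<^sub>\<infinity>n. x \<in> clopen_set (v n))"
    using selective_tower[OF assms] by blast
  interpret sparse_tower T using T by (rule sparse_tower.intro)
  have "T \<union> Fin - Fin = T" using T(1) by (auto simp: Fin_def)
  then show ?thesis
    using strong_gamma_setI[OF sel] not_Menger not_tau_set by (intro exI[of _ "T \<union> Fin"]) simp
qed

end
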